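(* Let $\mathbf I=\langle I,\vee\rangle$ be a join semilattice with least element $\bot$, let $\{\mathbf A_p: p\in I\}$ be a family of (pairwise disjoint) residuated posets, and let $\Phi=\{\varphi_{pq}\colon A_p\to A_q: p\le q\text{ in }\mathbf I\}$ and $\Psi=\{\psi_{pq}\colon A_p\to A_q: p\le q\text{ in }\mathbf I\}$ be semilattice directed systems of monotone maps such that $\Xi=\{\xi_{pq}\text{ from }\mathbf A_p\text{ to }\mathbf A_q: p\le q\text{ in }\mathbf I\}$ defined by $$\xi^1_{pq}=\langle\varphi_{pq}\rangle,\quad \xi^{\cdot}_{pq}=\langle\varphi_{pq},\varphi_{pq},\varphi_{pq}\rangle,\quad \xi^{\backslash}_{pq}=\langle\psi_{pq},\varphi_{pq},\psi_{pq}\rangle,\quad \xi^{/}_{pq}=\langle\psi_{pq},\psi_{pq},\varphi_{pq}\rangle$$ is a semilattice directed system of metamorphisms (of the algebraic reducts, in the type $\cdot,\backslash,/,1$). Suppose moreover that: (O1) if $p<q$ in $\mathbf I$, then $\psi_{pq}(a)<_q\varphi_{pq}(a)$ for all $a\in A_p$; (O2) if $p\le q$, $p\le r$ and $t=q\vee r$, then $\varphi_{qt}(\psi_{pq}(a))\le_t\psi_{rt}(\varphi_{pr}(a))$ for all $a\in A_p$; (O3) for all $p\le q$ and $a,b\in A_p$, if $\varphi_{pq}(a)\le_q\psi_{pq}(b)$, then $a\le_pb$. Then the Płonka sum of $\Xi$, together with the relation $\le$ on $A=\biguplus_pA_p$ given, for $a\in A_p$ and $b\in A_q$, by $$a\le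 b\iff\varphi_{ps}(a)\le_s\psi_{qs}(b),\quad s=p\vee q$$ (the sum of the poset reducts over $\langle\Phi,\Psi\rangle$), is a residuated poset.
   Context: A residuated poset is a structure $\mathbf A=\langle A,\le,\cdot,\backslash,/,1\rangle$ such that $\langle A,\le\rangle$ is a poset, $\langle A,\cdot,1\rangle$ is a monoid, and $x\cdot y\le z\iff x\le z/y\iff y\le x\backslash z$ for all $x,y,z\in A$. The order of $\mathbf A_p$ is denoted $\le_p$. A semilattice directed system of maps indexed by $\mathbf I$ is a family $\{\varphi_{pq}\colon A_p\to A_q: p\le q\text{ in }\mathbf I\}$ with $\varphi_{pp}=\mathrm{id}_{A_p}$ and $\varphi_{qr}\circ\varphi_{pq}=\varphi_{pr}$ whenever $p\le q\le r$. A metamorphism $f$ from $\mathbf A$ to $\mathbf B$ (algebras of the same type $\tau$) assigns to each $n$-ary symbol $\sigma$ of $\tau$ (constants included, $n=0$) a tuple $f^\sigma=\langle f^{\sigma0},\dots,f^{\sigma n}\rangle$ of maps $A\to B$ such that $f^{\sigma0}(\sigma^{\mathbf A}(a_1,\dots,a_n))=\sigma^{\mathbf B}(f^{\sigma1}(a_1),\dots,f^{\sigma n}(a_n))$ for all $a_1,\dots,a_n\in A$ (for a constant $\omega$: $f^{\omega0}(\omega^{\mathbf A})=\omega^{\mathbf B}$). Composition and identities are componentwise. A semilattice directed system of metamorphisms is a family $\{\xi_{pq}\text{ a metamorphism from }\mathbf A_p\text{ to }\mathbf A_q: p\le q\text{ in }\mathbf I\}$ with $\xi_{pp}$ the identity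 metamorphism and $\xi_{qr}\circ\xi_{pq}=\xi_{pr}$ for $p\le q\le r$. Its Płonka sum is the algebra on the disjoint union $\biguplus_pA_p$ with $\sigma(a_1,\dots,a_n)=\sigma^{\mathbf A_q}(\xi^{\sigma1}_{p_1q}(a_1),\dots,\xi^{\sigma n}_{p_nq}(a_n))$ for $a_k\in A_{p_k}$, $q=p_1\vee\dots\vee p_n$, and $\omega=\omega^{\mathbf A_\bot}$ for constant symbols $\omega$. *)

theory Defs
  imports "HOL-Algebra.Group" "HOL-Library.Disjoint_Sets"
begin

text \<open>
  A type of algebras is given by a type \<open>'f\<close> of operation symbols and an arity function
  \<open>ar :: 'f \<Rightarrow> nat\<close>.  An operation takes the list of its arguments; only lists of
  elements of the carrier, of length \<open>ar \<sigma>\<close>, are ever relevant.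
\<close>

record ('a, 'f) algebra = "'a partial_object" +
  interp :: "'f \<Rightarrow> 'a list \<Rightarrow> 'a"

definition is_algebra :: "('f \<Rightarrow> nat) \<Rightarrow> ('a, 'f) algebra \<Rightarrow> bool" where
  "is_algebra ar A \<longleftrightarrow>
     (\<forall>\<sigma>. \<forall>as \<in> lists (carrier A). length as = ar \<sigma> \<longrightarrow> interp A \<sigma> as \<in> carrier A)"

text \<open>
  A family \<open>f\<close> of tuples of maps is represented as \<open>f \<sigma> k\<close>, with \<open>k \<in> {0..ar \<sigma>}\<close>:
  index 0 acts on the value and indices 1, ..., \<open>ar \<sigma>\<close> act on the arguments.
\<close>

definition metamorphism ::
    "('f \<Rightarrow> nat) \<Rightarrow> ('a, 'f) algebra \<Rightarrow> ('b, 'f) algebra \<Rightarrow> ('f \<Rightarrow> nat \<Rightarrow> 'a \<Rightarrow> 'b) \<Rightarrow> bool" where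
  "metamorphism ar A B f \<longleftrightarrow>
     (\<forall>\<sigma>. \<forall>k \<le> ar \<sigma>. f \<sigma> k \<in> carrier A \<rightarrow> carrier B) \<and>
     (\<forall>\<sigma>. \<forall>as \<in> lists (carrier A). length as = ar \<sigma> \<longrightarrow>
        f \<sigma> 0 (interp A \<sigma> as) = interp B \<sigma> (map2 (f \<sigma>) [1..<Suc (ar \<sigma>)] as))"

definition directed_system_maps ::
    "('i::semilattice_sup \<Rightarrow> 'a set) \<Rightarrow> ('i \<Rightarrow> 'i \<Rightarrow> 'a \<Rightarrow> 'a) \<Rightarrow> bool" where
  "directed_system_maps C \<phi> \<longleftrightarrow>
     (\<forall>p q. p \<le> q \<longrightarrow> \<phi> p q \<in> C p \<rightarrow> C q) \<and>
     (\<forall>p. \<forall>a \<in> C p. \<phi> p p a = a) \<and>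
     (\<forall>p q r. p \<le> q \<longrightarrow> q \<le> r \<longrightarrow> (\<forall>a \<in> C p. \<phi> q r (\<phi> p q a) = \<phi> p r a))"

definition directed_system_metamorphisms ::
    "('f \<Rightarrow> nat) \<Rightarrow> ('i::semilattice_sup \<Rightarrow> ('a, 'f) algebra) \<Rightarrow>
     ('i \<Rightarrow> 'i \<Rightarrow> 'f \<Rightarrow> nat \<Rightarrow> 'a \<Rightarrow> 'a) \<Rightarrow> bool" where
  "directed_system_metamorphisms ar A \<xi> \<longleftrightarrow>
     (\<forall>p q. p \<le> q \<longrightarrow> metamorphism ar (A p) (A q) (\<xi> p q)) \<and>
     (\<forall>p. \<forall>\<sigma>. \<forall>k \<le> ar \<sigma>. \<forall>a \<in> carrier (A p). \<xi> p p \<sigma> k a = a) \<and>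
     (\<forall>p q r. p \<le> q \<longrightarrow> q \<le> r \<longrightarrow>
        (\<forall>\<sigma>. \<forall>k \<le> ar \<sigma>. \<forall>a \<in> carrier (A p). \<xi> q r \<sigma> k (\<xi> p q \<sigma> k a) = \<xi> p r \<sigma> k a))"

text \<open>The index of the member of a disjoint family to which an element belongs.\<close>

definition index_of :: "('i \<Rightarrow> 'a set) \<Rightarrow> 'a \<Rightarrow> 'i" where
  "index_of C a = (THE p. a \<in> C p)"

text \<open>
  Used for families with pairwise disjoint carriers, so that their union is the disjoint union.
  For at least one argument, folding from the least element gives the join of the indices;
  for a constant it gives the least element, so that constants are taken from \<open>A bot\<close>.
\<close>

definition plonka_sum ::
    "('i::bounded_semilattice_sup_bot \<Rightarrow> ('a, 'f) algebra) \<Rightarrow>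
     ('i \<Rightarrow> 'i \<Rightarrow> 'f \<Rightarrow> nat \<Rightarrow> 'a \<Rightarrow> 'a) \<Rightarrow> ('a, 'f) algebra" where
  "plonka_sum A \<xi> =
     (let ix = index_of (\<lambda>p. carrier (A p)) in
      \<lparr> carrier = (\<Union>p. carrier (A p)),
        interp = (\<lambda>\<sigma> as.
          let q = foldr sup (map ix as) bot
          in interp (A q) \<sigma> (map2 (\<lambda>k a. \<xi> (ix a) q \<sigma> k a) [1..<Suc (length as)] as)) \<rparr>)"

definition poset_sum_le ::
    "('i::semilattice_sup \<Rightarrow> 'a set) \<Rightarrow> ('i \<Rightarrow> 'a \<Rightarrow> 'a \<Rightarrow> bool) \<Rightarrow>
     ('i \<Rightarrow> 'i \<Rightarrow> 'a \<Rightarrow> 'a) \<Rightarrow> ('i \<Rightarrow> 'i \<Rightarrow> 'a \<Rightarrow> 'a) \<Rightarrow> 'a \<Rightarrow> 'a \<Rightarrow> bool" where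
  "poset_sum_le C leq \<phi> \<psi> a b \<longleftrightarrow>
     (let p = index_of C a; q = index_of C b; s = sup p q
      in leq s (\<phi> p s a) (\<psi> q s b))"

datatype rp_symbol = Unit_sym | Mult_sym | LDiv_sym | RDiv_sym

primrec rp_arity :: "rp_symbol \<Rightarrow> nat" where
  "rp_arity Unit_sym = 0"
| "rp_arity Mult_sym = 2"
| "rp_arity LDiv_sym = 2"
| "rp_arity RDiv_sym = 2"

abbreviation rp_unit :: "('a, rp_symbol) algebra \<Rightarrow> 'a" where
  "rp_unit A \<equiv> interp A Unit_sym []"

abbreviation rp_mult :: "('a, rp_symbol) algebra \<Rightarrow> 'a \<Rightarrow> 'a \<Rightarrow> 'a" where
  "rp_mult A x y \<equiv> interp A Mult_sym [x, y]"

text \<open>\<open>rp_ldiv A x z\<close> is \<open>x\<close> under \<open>z\<close>, and \<open>rp_rdiv A z y\<close> is \<open>z\<close> over \<open>y\<close>.\<close>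

abbreviation rp_ldiv :: "('a, rp_symbol) algebra \<Rightarrow> 'a \<Rightarrow> 'a \<Rightarrow> 'a" where
  "rp_ldiv A x z \<equiv> interp A LDiv_sym [x, z]"

abbreviation rp_rdiv :: "('a, rp_symbol) algebra \<Rightarrow> 'a \<Rightarrow> 'a \<Rightarrow> 'a" where
  "rp_rdiv A z y \<equiv> interp A RDiv_sym [z, y]"

definition residuated_poset ::
    "('a, rp_symbol) algebra \<Rightarrow> ('a \<Rightarrow> 'a \<Rightarrow> bool) \<Rightarrow> bool" where
  "residuated_poset A leq \<longleftrightarrow>
     is_algebra rp_arity A \<and>
     reflp_on (carrier A) leq \<and> antisymp_on (carrier A) leq \<and> transp_on (carrier A) leq \<and>
     monoid \<lparr> carrier = carrier A, monoid.mult = rp_mult A, one = rp_unit A \<rparr> \<and>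
     (\<forall>x \<in> carrier A. \<forall>y \<in> carrier A. \<forall>z \<in> carrier A.
        (leq (rp_mult A x y) z \<longleftrightarrow> leq x (rp_rdiv A z y)) \<and>
        (leq x (rp_rdiv A z y) \<longleftrightarrow> leq y (rp_ldiv A x z)))"

primrec rp_tuple :: "('a \<Rightarrow> 'b) \<Rightarrow> ('a \<Rightarrow> 'b) \<Rightarrow> rp_symbol \<Rightarrow> ('a \<Rightarrow> 'b) list" where
  "rp_tuple f g Unit_sym = [f]"
| "rp_tuple f g Mult_sym = [f, f, f]"
| "rp_tuple f g LDiv_sym = [g, f, g]"
| "rp_tuple f g RDiv_sym = [g, g, f]"

definition rp_xi ::
    "('i \<Rightarrow> 'i \<Rightarrow> 'a \<Rightarrow> 'a) \<Rightarrow> ('i \<Rightarrow> 'i \<Rightarrow> 'a \<Rightarrow> 'a) \<Rightarrow> 'i \<Rightarrow> 'i \<Rightarrow> rp_symbol \<Rightarrow> nat \<Rightarrow> 'a \<Rightarrow> 'a" where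
  "rp_xi \<phi> \<psi> p q \<sigma> k = rp_tuple (\<phi> p q) (\<psi> p q) \<sigma> ! k"

end

theory Submission
  imports Defs
begin

text \<open>
  Monotonicity pushes the two inequalities of \<open>a \<le> b \<le> c\<close> up to the join of all three
  indices; there (O2) links them through \<open>b\<close>, and (O3) pulls the result back to the join
  of the indices of \<open>a\<close> and \<open>c\<close>.  Antisymmetry is (O1): a cycle \<open>a \<le> b \<le> a\<close> across distinct
  indices would give \<open>\<phi> a \<le> \<psi> b \<le> \<phi> b \<le> \<psi> a\<close> at the join.  The maps \<open>\<phi>\<close> are monoid
  homomorphisms, which gives the monoid laws, and since \<open>\<psi> (z / y) = \<psi> z / \<phi> y\<close> and
  \<open>\<psi> (x \ z) = \<phi> x \ \<psi> z\<close>, each residuation law is the residuation law in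
  the member of the family at the join of the indices of \<open>x\<close>, \<open>y\<close>, \<open>z\<close>.
\<close>

section \<open>The order on the disjoint union\<close>

lemma index_of_eq:
  assumes "disjoint_family C" "a \<in> C p"
  shows "index_of C a = p"
  unfolding index_of_def
proof (rule the_equality)
  show "a \<in> C p" by fact
next
  fix q assume "a \<in> C q"
  then show "q = p"
    using assms by (auto simp: disjoint_family_on_def)
qed

text \<open>Collects the order-theoretic hypotheses apart from the operations, since they alone make
  the relation on the union a partial order; the theorem instantiates \<open>C\<close> with the
  carriers.\<close>

locale poset_system =
  fixes C :: "'i::semilattice_sup \<Rightarrow> 'a set"
    and leq :: "'i \<Rightarrow> 'a \<Rightarrow> 'a \<Rightarrow> bool"
    and \<phi> \<psi> :: "'i \<Rightarrow> 'i \<Rightarrow> 'a \<Rightarrow> 'a"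
  assumes disjoint: "disjoint_family C"
    and reflp_leq: "\<And>p. reflp_on (C p) (leq p)"
    and antisymp_leq: "\<And>p. antisymp_on (C p) (leq p)"
    and transp_leq: "\<And>p. transp_on (C p) (leq p)"
    and directed_phi: "directed_system_maps C \<phi>"
    and directed_psi: "directed_system_maps C \<psi>"
    and monotone_phi: "\<And>p q. p \<le> q \<Longrightarrow> monotone_on (C p) (leq p) (leq q) (\<phi> p q)"
    and monotone_psi: "\<And>p q. p \<le> q \<Longrightarrow> monotone_on (C p) (leq p) (leq q) (\<psi> p q)"
    and O1: "\<And>p q a. p < q \<Longrightarrow> a \<in> C p \<Longrightarrow>
               leq q (\<psi> p q a) (\<phi> p q a) \<and> \<psi> p q a \<noteq> \<phi> p q a"
    and O2: "\<And>p q r t a. p \<le> q \<Longrightarrow> p \<le> r \<Longrightarrow> t = sup q r \<Longrightarrow> a \<in> C p \<Longrightarrow>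
               leq t (\<phi> q t (\<psi> p q a)) (\<psi> r t (\<phi> p r a))"
    and O3: "\<And>p q a b. p \<le> q \<Longrightarrow> a \<in> C p \<Longrightarrow> b \<in> C p \<Longrightarrow>
               leq q (\<phi> p q a) (\<psi> p q b) \<Longrightarrow> leq p a b"
begin

abbreviation sum_le (infix \<open>\<preceq>\<close> 50) where
  "sum_le \<equiv> poset_sum_le C leq \<phi> \<psi>"

lemma index_eq: "a \<in> C p \<Longrightarrow> index_of C a = p"
  using disjoint by (rule index_of_eq)

lemma phi_closed: "p \<le> q \<Longrightarrow> a \<in> C p \<Longrightarrow> \<phi> p q a \<in> C q"
  and phi_id: "a \<in> C p \<Longrightarrow> \<phi> p p a = a"
  and phi_comp: "p \<le> q \<Longrightarrow> q \<le> r \<Longrightarrow> a \<in> C p \<Longrightarrow> \<phi> q r (\<phi> p q a) = \<phi> p r a"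
  using directed_phi unfolding directed_system_maps_def by blast+

lemma psi_closed: "p \<le> q \<Longrightarrow> a \<in> C p \<Longrightarrow> \<psi> p q a \<in> C q"
  and psi_id: "a \<in> C p \<Longrightarrow> \<psi> p p a = a"
  and psi_comp: "p \<le> q \<Longrightarrow> q \<le> r \<Longrightarrow> a \<in> C p \<Longrightarrow> \<psi> q r (\<psi> p q a) = \<psi> p r a"
  using directed_psi unfolding directed_system_maps_def by blast+

lemma leq_refl: "a \<in> C p \<Longrightarrow> leq p a a"
  by (rule reflp_onD [OF reflp_leq])

lemma leq_antisym: "leq p a b \<Longrightarrow> leq p b a \<Longrightarrow> a \<in> C p \<Longrightarrow> b \<in> C p \<Longrightarrow> a = b"
  by (rule antisymp_onD [OF antisymp_leq])

lemma leq_trans: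
  "leq p a b \<Longrightarrow> leq p b c \<Longrightarrow> a \<in> C p \<Longrightarrow> b \<in> C p \<Longrightarrow> c \<in> C p \<Longrightarrow> leq p a c"
  using transp_leq [of p] by (blast dest: transp_onD)

lemma phi_mono: "p \<le> q \<Longrightarrow> a \<in> C p \<Longrightarrow> b \<in> C p \<Longrightarrow> leq p a b \<Longrightarrow> leq q (\<phi> p q a) (\<phi> p q b)"
  using monotone_phi by (auto simp: monotone_on_def)

lemma psi_mono: "p \<le> q \<Longrightarrow> a \<in> C p \<Longrightarrow> b \<in> C p \<Longrightarrow> leq p a b \<Longrightarrow> leq q (\<psi> p q a) (\<psi> p q b)"
  using monotone_psi by (auto simp: monotone_on_def)

lemma psi_le_phi:
  assumes "p \<le> q" "a \<in> C p"
  shows "leq q (\<psi> p q a) (\<phi> p q a)"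
proof (cases "p = q")
  case True
  then show ?thesis using assms by (simp add: phi_id psi_id leq_refl)
next
  case False
  then show ?thesis using O1 assms by simp
qed

text \<open>The join enters through an equation for \<open>s\<close>, so that the lemma can be
  applied with a join that is bracketed differently.\<close>

lemma sum_le_iff:
  assumes "a \<in> C p" "b \<in> C q" "s = sup p q"
  shows "a \<preceq> b \<longleftrightarrow> leq s (\<phi> p s a) (\<psi> q s b)"
  using assms by (simp add: poset_sum_le_def index_eq Let_def)

lemma sum_le_refl: "reflp_on (\<Union>p. C p) (\<preceq>)"
  by (rule reflp_onI) (auto simp: sum_le_iff phi_id psi_id leq_refl)

lemma sum_le_antisym: "antisymp_on (\<Union>p. C p) (\<preceq>)"
proof (rule antisymp_onI)
  fix a b assume "a \<in> (\<Union>p. C p)" "b \<in> (\<Union>p. C p)" and ab: "a \<preceq> b" and ba: "b \<preceq> a"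
  then obtain p q where a: "a \<in> C p" and b: "b \<in> C q" by blast
  define s where "s = sup p q"
  have ps: "p \<le> s" and qs: "q \<le> s" by (simp_all add: s_def)
  note closed = phi_closed [OF ps a] psi_closed [OF ps a] phi_closed [OF qs b] psi_closed [OF qs b]
  have 1: "leq s (\<phi> p s a) (\<psi> q s b)"
    using ab sum_le_iff [OF a b s_def] by simp
  have 2: "leq s (\<phi> q s b) (\<psi> p s a)"
    using ba sum_le_iff [OF b a] by (simp add: s_def sup_commute)
  have le_a: "leq s (\<phi> p s a) (\<psi> p s a)"
    using leq_trans [OF leq_trans [OF 1 psi_le_phi [OF qs b]] 2] closed by blast
  have le_b: "leq s (\<phi> q s b) (\<psi> q s b)"
    using leq_trans [OF leq_trans [OF 2 psi_le_phi [OF ps a]] 1] closed by blast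
  \<comment> \<open>By \<open>psi_le_phi\<close> and \<open>le_a\<close>, the images \<phi> p s a
    and \<psi> p s a coincide, which (O1) excludes if p < s. The same argument with
    \<open>le_b\<close> gives q = s.\<close>
  have "p = s"
    using O1 [of p s a] leq_antisym [OF psi_le_phi [OF ps a] le_a] closed ps a
    by (auto simp: order.order_iff_strict)
  moreover have "q = s"
    using O1 [of q s b] leq_antisym [OF psi_le_phi [OF qs b] le_b] closed qs b
    by (auto simp: order.order_iff_strict)
  \<comment> \<open>Both elements now lie in the member at \<open>s\<close> and all maps are
    identities, so \<open>1\<close> and \<open>2\<close> compare a and b directly.\<close>
  ultimately show "a = b"
    using 1 2 a b by (metis leq_antisym phi_id psi_id)
qed

lemma sum_le_trans: "transp_on (\<Union>p. C p) (\<preceq>)"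
proof (rule transp_onI)
  fix a b c assume "a \<in> (\<Union>p. C p)" "b \<in> (\<Union>p. C p)" "c \<in> (\<Union>p. C p)"
    and ab: "a \<preceq> b" and bc: "b \<preceq> c"
  then obtain p q r where a: "a \<in> C p" and b: "b \<in> C q" and c: "c \<in> C r" by blast
  \<comment> \<open>The hypotheses are comparisons at \<open>s\<close> and \<open>u\<close>, the
    goal is one at \<open>v\<close>, and \<open>t\<close> lies above all three.\<close>
  define s u v t where "s = sup p q" and "u = sup q r" and "v = sup p r" and "t = sup s u"
  have ps: "p \<le> s" and qs: "q \<le> s" and qu: "q \<le> u" and ru: "r \<le> u"
    and pv: "p \<le> v" and rv: "r \<le> v" and st: "s \<le> t" and ut: "u \<le> t"
    by (simp_all add: s_def u_def v_def t_def)
  have vt: "v \<le> t"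
    by (simp add: s_def u_def v_def t_def le_supI1 le_supI2)
  note closed = phi_closed psi_closed a b c ps qs qu ru pv rv st ut vt
  have "leq t (\<phi> s t (\<phi> p s a)) (\<phi> s t (\<psi> q s b))"
    using ab sum_le_iff [OF a b s_def] by (simp add: phi_mono closed)
  \<comment> \<open>Here b travels to \<open>t\<close> by two routes, through \<open>s\<close> and
    through \<open>u\<close>; (O2) compares them.\<close>
  moreover have "leq t (\<phi> s t (\<psi> q s b)) (\<psi> u t (\<phi> q u b))"
    using O2 [OF qs qu t_def b] .
  moreover have "leq t (\<psi> u t (\<phi> q u b)) (\<psi> u t (\<psi> r u c))"
    using bc sum_le_iff [OF b c u_def] by (simp add: psi_mono closed)
  ultimately have "leq t (\<phi> s t (\<phi> p s a)) (\<psi> u t (\<psi> r u c))"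
    using leq_trans closed by metis
  \<comment> \<open>Both sides are rerouted through \<open>v\<close>, which gives the shape from
    which (O3) descends from \<open>t\<close> to \<open>v\<close>.\<close>
  then have "leq t (\<phi> v t (\<phi> p v a)) (\<psi> v t (\<psi> r v c))"
    using phi_comp [OF ps st a] phi_comp [OF pv vt a] psi_comp [OF ru ut c] psi_comp [OF rv vt c]
    by simp
  then have "leq v (\<phi> p v a) (\<psi> r v c)"
    using O3 [OF vt] closed by blast
  then show "a \<preceq> c"
    using sum_le_iff [OF a c v_def] by simp
qed

end

section \<open>The residuated structure of the Plonka sum\<close>

theorem theorem22:
  fixes A :: "'i::bounded_semilattice_sup_bot \<Rightarrow> ('a, rp_symbol) algebra"
    and leq :: "'i \<Rightarrow> 'a \<Rightarrow> 'a \<Rightarrow> bool"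
    and \<phi> \<psi> :: "'i \<Rightarrow> 'i \<Rightarrow> 'a \<Rightarrow> 'a"
  assumes "\<And>p. residuated_poset (A p) (leq p)"
    and "disjoint_family (\<lambda>p. carrier (A p))"
    and "directed_system_maps (\<lambda>p. carrier (A p)) \<phi>"
    and "directed_system_maps (\<lambda>p. carrier (A p)) \<psi>"
    and "\<And>p q. p \<le> q \<Longrightarrow> monotone_on (carrier (A p)) (leq p) (leq q) (\<phi> p q)"
    and "\<And>p q. p \<le> q \<Longrightarrow> monotone_on (carrier (A p)) (leq p) (leq q) (\<psi> p q)"
    and "directed_system_metamorphisms rp_arity A (rp_xi \<phi> \<psi>)"
    and O1: "\<And>p q a. p < q \<Longrightarrow> a \<in> carrier (A p) \<Longrightarrow>
               leq q (\<psi> p q a) (\<phi> p q a) \<and> \<psi> p q a \<noteq> \<phi> p q a"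
    and O2: "\<And>p q r t a. p \<le> q \<Longrightarrow> p \<le> r \<Longrightarrow> t = sup q r \<Longrightarrow> a \<in> carrier (A p) \<Longrightarrow>
               leq t (\<phi> q t (\<psi> p q a)) (\<psi> r t (\<phi> p r a))"
    and O3: "\<And>p q a b. p \<le> q \<Longrightarrow> a \<in> carrier (A p) \<Longrightarrow> b \<in> carrier (A p) \<Longrightarrow>
               leq q (\<phi> p q a) (\<psi> p q b) \<Longrightarrow> leq p a b"
  shows "residuated_poset (plonka_sum A (rp_xi \<phi> \<psi>))
           (poset_sum_le (\<lambda>p. carrier (A p)) leq \<phi> \<psi>)"
proof -
  let ?C = "\<lambda>p. carrier (A p)"
  let ?\<xi> = "rp_xi \<phi> \<psi>"
  let ?S = "plonka_sum A ?\<xi>"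
  let ?le = "poset_sum_le ?C leq \<phi> \<psi>"
  note rp = assms(1) [unfolded residuated_poset_def]
  interpret poset_system ?C leq \<phi> \<psi>
  proof (unfold_locales, goal_cases)
    case 1 show ?case by (rule assms(2))
  next
    case (2 p) show ?case using rp by blast
  next
    case (3 p) show ?case using rp by blast
  next
    case (4 p) show ?case using rp by blast
  next
    case 5 show ?case by (rule assms(3))
  next
    case 6 show ?case by (rule assms(4))
  next
    case 7 then show ?case by (rule assms(5))
  next
    case 8 then show ?case by (rule assms(6))
  next
    case 9 then show ?case by (rule O1)
  next
    case 10 then show ?case by (rule O2)
  next
    case 11 then show ?case by (rule O3)
  qed
  have meta: "metamorphism rp_arity (A p) (A q) (?\<xi> p q)" if "p \<le> q" for p q
    using assms(7) that by (simp add: directed_system_metamorphisms_def)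
  \<comment> \<open>Slot 0 of \<open>rp_xi\<close> is \<phi> for unit and product but \<psi> for the
    residuals. The four instances below therefore describe \<phi> on the monoid operations and
    \<psi> on quotients, with \<phi> acting on denominators.\<close>
  have hom: "?\<xi> p q \<sigma> 0 (interp (A p) \<sigma> as) = interp (A q) \<sigma> (map2 (?\<xi> p q \<sigma>) [1..<Suc (rp_arity \<sigma>)] as)"
    if "p \<le> q" "as \<in> lists (?C p)" "length as = rp_arity \<sigma>" for p q \<sigma> as
    using meta [OF that(1)] that(2,3) by (simp add: metamorphism_def)
  have phi_unit: "\<phi> p q (rp_unit (A p)) = rp_unit (A q)" if "p \<le> q" for p q
    using hom [OF that, of "[]" Unit_sym] by (simp add: rp_xi_def)
  have phi_mult: "\<phi> p q (rp_mult (A p) x y) = rp_mult (A q) (\<phi> p q x) (\<phi> p q y)"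
    if "p \<le> q" "x \<in> ?C p" "y \<in> ?C p" for p q x y
    using hom [OF that(1), of "[x, y]" Mult_sym] that
    by (simp add: rp_xi_def upt_conv_Cons numeral_2_eq_2)
  have psi_ldiv: "\<psi> p q (rp_ldiv (A p) x z) = rp_ldiv (A q) (\<phi> p q x) (\<psi> p q z)"
    if "p \<le> q" "x \<in> ?C p" "z \<in> ?C p" for p q x z
    using hom [OF that(1), of "[x, z]" LDiv_sym] that
    by (simp add: rp_xi_def upt_conv_Cons numeral_2_eq_2)
  have psi_rdiv: "\<psi> p q (rp_rdiv (A p) z y) = rp_rdiv (A q) (\<psi> p q z) (\<phi> p q y)"
    if "p \<le> q" "z \<in> ?C p" "y \<in> ?C p" for p q z y
    using hom [OF that(1), of "[z, y]" RDiv_sym] that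
    by (simp add: rp_xi_def upt_conv_Cons numeral_2_eq_2)

  have carrier_S: "carrier ?S = (\<Union>p. ?C p)"
    by (simp add: plonka_sum_def Let_def)
  have interp_S: "interp ?S \<sigma> as =
      (let ix = index_of ?C; q = foldr sup (map ix as) bot
       in interp (A q) \<sigma> (map2 (\<lambda>k a. ?\<xi> (ix a) q \<sigma> k a) [1..<Suc (length as)] as))" for \<sigma> as
    by (simp add: plonka_sum_def Let_def)
  note interp_S_simps = interp_S Let_def index_eq rp_xi_def upt_conv_Cons
  \<comment> \<open>On the empty argument list the fold returns its start value
    \<open>bot\<close>.\<close>
  have S_unit: "rp_unit ?S = rp_unit (A bot)"
    by (simp add: interp_S_simps)
  \<comment> \<open>For two arguments the fold yields sup p (sup q bot), which is sup p q.\<close>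
  have S_mult: "rp_mult ?S x y = rp_mult (A s) (\<phi> p s x) (\<phi> q s y)"
    and S_ldiv: "rp_ldiv ?S x y = rp_ldiv (A s) (\<phi> p s x) (\<psi> q s y)"
    and S_rdiv: "rp_rdiv ?S x y = rp_rdiv (A s) (\<psi> p s x) (\<phi> q s y)"
    if "x \<in> ?C p" "y \<in> ?C q" "s = sup p q" for x y p q s
    using that by (simp_all add: interp_S_simps numeral_2_eq_2)

  have closed: "interp (A p) \<sigma> as \<in> ?C p"
    if "as \<in> lists (?C p)" "length as = rp_arity \<sigma>" for p \<sigma> as
    using rp that by (auto simp: is_algebra_def)
  have unit_closed: "rp_unit (A p) \<in> ?C p" for p
    by (rule closed) auto
  have mult_closed: "rp_mult (A p) x y \<in> ?C p"
    and ldiv_closed: "rp_ldiv (A p) x y \<in> ?C p"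
    and rdiv_closed: "rp_rdiv (A p) x y \<in> ?C p"
    if "x \<in> ?C p" "y \<in> ?C p" for p x y
    using that by (auto intro!: closed)
  have mon: "monoid \<lparr>carrier = ?C p, monoid.mult = rp_mult (A p), one = rp_unit (A p)\<rparr>" for p
    using rp by blast
  have mult_assoc: "rp_mult (A p) (rp_mult (A p) x y) z = rp_mult (A p) x (rp_mult (A p) y z)"
    if "x \<in> ?C p" "y \<in> ?C p" "z \<in> ?C p" for p x y z
    using monoid.m_assoc [OF mon [of p]] that by simp
  have mult_unit: "rp_mult (A p) (rp_unit (A p)) x = x" "rp_mult (A p) x (rp_unit (A p)) = x"
    if "x \<in> ?C p" for p x
    using monoid.l_one [OF mon [of p]] monoid.r_one [OF mon [of p]] that by simp_all
  have residuation: "leq p (rp_mult (A p) x y) z \<longleftrightarrow> leq p x (rp_rdiv (A p) z y)"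
    "leq p x (rp_rdiv (A p) z y) \<longleftrightarrow> leq p y (rp_ldiv (A p) x z)"
    if "x \<in> ?C p" "y \<in> ?C p" "z \<in> ?C p" for p x y z
    using rp that by blast+

  \<comment> \<open>Closure and the monoid laws\<close>
  have "is_algebra rp_arity ?S"
    unfolding is_algebra_def carrier_S
  proof (intro allI ballI impI)
    fix \<sigma> as assume as: "as \<in> lists (\<Union>p. ?C p)" and len: "length as = rp_arity \<sigma>"
    show "interp ?S \<sigma> as \<in> (\<Union>p. ?C p)"
    proof (cases "\<sigma> = Unit_sym")
      case True
      then show ?thesis using len S_unit unit_closed by auto
    next
      case False
      \<comment> \<open>Every symbol other than the unit is binary.\<close>
      then obtain x y where xy: "as = [x, y]"
        using len by (cases \<sigma>) (auto simp: numeral_2_eq_2 length_Suc_conv)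
      with as obtain p q where "x \<in> ?C p" "y \<in> ?C q" by auto
      moreover define s where "s = sup p q"
      moreover have "p \<le> s" "q \<le> s" by (simp_all add: s_def)
      ultimately have "interp ?S \<sigma> as \<in> ?C s"
        using False S_mult S_ldiv S_rdiv
        by (cases \<sigma>) (simp_all add: xy mult_closed ldiv_closed rdiv_closed phi_closed psi_closed)
      then show ?thesis by blast
    qed
  qed
  moreover have "monoid \<lparr>carrier = carrier ?S, monoid.mult = rp_mult ?S, one = rp_unit ?S\<rparr>"
  proof (rule monoidI; simp only: partial_object.select_convs monoid.select_convs carrier_S)
    show "rp_unit ?S \<in> (\<Union>p. ?C p)"
      using S_unit unit_closed by auto
  next
    fix x y assume "x \<in> (\<Union>p. ?C p)" "y \<in> (\<Union>p. ?C p)"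
    then show "rp_mult ?S x y \<in> (\<Union>p. ?C p)"
      using \<open>is_algebra rp_arity ?S\<close> by (auto simp: is_algebra_def carrier_S)
  next
    fix x assume "x \<in> (\<Union>p. ?C p)"
    then obtain p where x: "x \<in> ?C p" by blast
    \<comment> \<open>The unit has index \<open>bot\<close>, so the product is computed in the
      member of x itself, where \<phi> sends the unit to the unit and fixes x.\<close>
    show "rp_mult ?S (rp_unit ?S) x = x"
      using S_mult [OF unit_closed x refl] x by (simp add: S_unit phi_unit phi_id mult_unit)
    show "rp_mult ?S x (rp_unit ?S) = x"
      using S_mult [OF x unit_closed refl] x by (simp add: S_unit phi_unit phi_id mult_unit)
  next
    fix x y z assume "x \<in> (\<Union>p. ?C p)" "y \<in> (\<Union>p. ?C p)" "z \<in> (\<Union>p. ?C p)"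
    then obtain p q r where x: "x \<in> ?C p" and y: "y \<in> ?C q" and z: "z \<in> ?C r" by blast
    define s u t where "s = sup p q" and "u = sup q r" and "t = sup s r"
    have le: "p \<le> s" "q \<le> s" "q \<le> u" "r \<le> u" "s \<le> t" "u \<le> t" "r \<le> t" "p \<le> t" "q \<le> t"
      by (simp_all add: s_def u_def t_def le_supI1 le_supI2)
    \<comment> \<open>The other bracketing of the join, needed to evaluate the right-nested product
      in the same member \<open>A t\<close>.\<close>
    have t': "t = sup p u"
      by (simp add: s_def u_def t_def sup_assoc)
    have "rp_mult ?S (rp_mult ?S x y) z =
        rp_mult (A t) (rp_mult (A t) (\<phi> p t x) (\<phi> q t y)) (\<phi> r t z)"
      using S_mult [OF x y s_def] S_mult [OF mult_closed z t_def] x y le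
      by (simp add: phi_closed phi_mult phi_comp)
    also have "\<dots> = rp_mult (A t) (\<phi> p t x) (rp_mult (A t) (\<phi> q t y) (\<phi> r t z))"
      using x y z le by (simp add: mult_assoc phi_closed)
    also have "\<dots> = rp_mult ?S x (rp_mult ?S y z)"
      using S_mult [OF y z u_def] S_mult [OF x mult_closed t'] y z le
      by (simp add: phi_closed phi_mult phi_comp)
    finally show "rp_mult ?S (rp_mult ?S x y) z = rp_mult ?S x (rp_mult ?S y z)" .
  qed

  \<comment> \<open>Residuation\<close>
  moreover have "(?le (rp_mult ?S x y) z \<longleftrightarrow> ?le x (rp_rdiv ?S z y)) \<and>
      (?le x (rp_rdiv ?S z y) \<longleftrightarrow> ?le y (rp_ldiv ?S x z))"
    if "x \<in> carrier ?S" "y \<in> carrier ?S" "z \<in> carrier ?S" for x y z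
  proof -
    from that obtain p q r where x: "x \<in> ?C p" and y: "y \<in> ?C q" and z: "z \<in> ?C r"
      unfolding carrier_S by blast
    \<comment> \<open>The product, the right quotient and the left quotient live at
      \<open>s\<close>, \<open>u\<close> and \<open>v\<close>; all three comparisons take place at
      \<open>t\<close>.\<close>
    define s u v t where "s = sup p q" and "u = sup r q" and "v = sup p r" and "t = sup s r"
    have le: "p \<le> s" "q \<le> s" "r \<le> u" "q \<le> u" "p \<le> v" "r \<le> v"
      "s \<le> t" "u \<le> t" "v \<le> t" "p \<le> t" "q \<le> t" "r \<le> t"
      by (simp_all add: s_def u_def v_def t_def le_supI1 le_supI2)
    have t': "t = sup p u" "t = sup q v"
      by (simp_all add: s_def u_def v_def t_def ac_simps)
    note closed = phi_closed psi_closed mult_closed ldiv_closed rdiv_closed x y z le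
    \<comment> \<open>The product is on the left of the order, so it moves from \<open>s\<close> to
      \<open>t\<close> by \<phi>, which is multiplicative.\<close>
    have "?le (rp_mult ?S x y) z \<longleftrightarrow> leq t (rp_mult (A t) (\<phi> p t x) (\<phi> q t y)) (\<psi> r t z)"
      using S_mult [OF x y s_def] sum_le_iff [OF mult_closed z t_def]
      by (simp add: closed phi_mult phi_comp)
    \<comment> \<open>A quotient is on the right of the order, so it moves to \<open>t\<close> by
      \<psi>. By \<open>psi_rdiv\<close> the numerator keeps using \<psi> and the denominator
      \<phi>, so both collapse to the same images in \<open>A t\<close> as in the product
      case.\<close>
    moreover have "?le x (rp_rdiv ?S z y) \<longleftrightarrow> leq t (\<phi> p t x) (rp_rdiv (A t) (\<psi> r t z) (\<phi> q t y))"
      using S_rdiv [OF z y u_def] sum_le_iff [OF x rdiv_closed t'(1)]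
      by (simp add: closed psi_rdiv phi_comp psi_comp)
    moreover have "?le y (rp_ldiv ?S x z) \<longleftrightarrow> leq t (\<phi> q t y) (rp_ldiv (A t) (\<phi> p t x) (\<psi> r t z))"
      using S_ldiv [OF x z v_def] sum_le_iff [OF y ldiv_closed t'(2)]
      by (simp add: closed psi_ldiv phi_comp psi_comp)
    ultimately show ?thesis
      using residuation by (simp add: closed)
  qed
  ultimately show ?thesis
    unfolding residuated_poset_def
    using sum_le_refl sum_le_antisym sum_le_trans by (simp add: carrier_S)
qed

end
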